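(* Let $X$ be a nonempty set and let $\alpha,\beta\in\Gamma(X)$. Then $\alpha\sim_c\beta$ in $\Gamma(X)$ if and only if $|A_\alpha|+|B_\alpha|=|A_\beta|+|B_\beta|$, $|B_\alpha|=|B_\beta|$, and $|C^n_\alpha|=|C^n_\beta|$ for every $n\geq1$.
   Context: Conjugacy. For a semigroup $S$, $S^1$ is $S$ if $S$ is a monoid, and $S$ with an identity adjoined otherwise. If $S$ has a zero $0$ and $0\ne a\in S$, let $\mathbb{P}(a)=\{g\in S:(ma)g\neq 0\text{ for all }ma\in S^1a\setminus\{0\}\}$, and $\mathbb{P}(0)=\{0\}$; if $S$ has no zero, $\mathbb{P}(a)=S$ for all $a$. Put $\mathbb{P}^1(a)=\mathbb{P}(a)\cup\{1\}$. Then $a\sim_c b$ iff there are $g\in\mathbb{P}^1(a)$, $h\in\mathbb{P}^1(b)$ with $ag=gb$ and $bh=ha$. $\Gamma(X)$ is the semigroup of all injective maps $X\to X$ (full transformations), written on the right and composed left to right. The following partial maps on $X$ are considered (all listed $x_i$ distinct; each is defined only by the displayed arrows $x\to x\sigma$): a cycle of length $k\ge1$: $x_0\to x_1\to\cdots\to x_{k-1}\to x_0$; a right ray: $x_0\to x_1\to x_2\to\cdots$; a double ray: $\cdots\to x_{-1}\to x_0\to x_1\to\cdots$. A partial map $\sigma$ is contained in $\alpha$ if $x\sigma=x\alpha$ for all $x\in\mathrm{dom}(\sigma)$. A right ray $x_0\to x_1\to\cdots$ contained in $\alpha\in\Gamma(X)$ is maximal if $x_0\notin\mathrm{im}(\alpha)$.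 For $\alpha\in\Gamma(X)$, $A_\alpha$ is the set of maximal right rays contained in $\alpha$, $B_\alpha$ the set of double rays contained in $\alpha$, and, for $n\ge1$, $C^n_\alpha$ the set of cycles of length $n$ contained in $\alpha$ (rays and cycles being identified when they are equal as partial maps). *)

theory Defs
  imports Main
begin

unbundle cardinal_syntax

text \<open>
  A semigroup is given by a carrier \<open>S\<close> and a multiplication \<open>m\<close>. The definitions below are
  intended for \<open>m\<close> closed and associative on \<open>S\<close>.
\<close>

definition is_identity :: "'s set \<Rightarrow> ('s \<Rightarrow> 's \<Rightarrow> 's) \<Rightarrow> 's \<Rightarrow> bool" where
  "is_identity S m e \<longleftrightarrow> e \<in> S \<and> (\<forall>x\<in>S. m e x = x \<and> m x e = x)"

definition is_zero :: "'s set \<Rightarrow> ('s \<Rightarrow> 's \<Rightarrow> 's) \<Rightarrow> 's \<Rightarrow> bool" where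
  "is_zero S m z \<longleftrightarrow> z \<in> S \<and> (\<forall>x\<in>S. m z x = z \<and> m x z = z)"

text \<open>
  The monoid \<open>S\<^sup>1\<close> lives in the option type: \<open>Some x\<close> is the element \<open>x\<close> of \<open>S\<close>, and \<open>None\<close> is
  the adjoined identity, which belongs to \<open>S\<^sup>1\<close> only if \<open>S\<close> is not a monoid.
\<close>

definition carrier1 :: "'s set \<Rightarrow> ('s \<Rightarrow> 's \<Rightarrow> 's) \<Rightarrow> 's option set" where
  "carrier1 S m = (if \<exists>e. is_identity S m e then Some ` S else insert None (Some ` S))"

fun mult1 :: "('s \<Rightarrow> 's \<Rightarrow> 's) \<Rightarrow> 's option \<Rightarrow> 's option \<Rightarrow> 's option" where
  "mult1 m (Some x) (Some y) = Some (m x y)"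
| "mult1 m None y = y"
| "mult1 m (Some x) None = Some x"

definition one1 :: "'s set \<Rightarrow> ('s \<Rightarrow> 's \<Rightarrow> 's) \<Rightarrow> 's option" where
  "one1 S m = (if \<exists>e. is_identity S m e then Some (THE e. is_identity S m e) else None)"

definition left_multiples :: "'s set \<Rightarrow> ('s \<Rightarrow> 's \<Rightarrow> 's) \<Rightarrow> 's \<Rightarrow> 's set" where
  "left_multiples S m a = {x. \<exists>s\<in>carrier1 S m. mult1 m s (Some a) = Some x}"

text \<open>
  The set \<open>\<bbbP>(a)\<close>. The middle case is \<open>a = 0\<close>, where \<open>{a}\<close> is \<open>{0}\<close>.
\<close>

definition PP :: "'s set \<Rightarrow> ('s \<Rightarrow> 's \<Rightarrow> 's) \<Rightarrow> 's \<Rightarrow> 's set" where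
  "PP S m a =
    (if \<nexists>z. is_zero S m z then S
     else if is_zero S m a then {a}
     else {g \<in> S. \<forall>x\<in>left_multiples S m a. \<not> is_zero S m x \<longrightarrow> \<not> is_zero S m (m x g)})"

definition PP1 :: "'s set \<Rightarrow> ('s \<Rightarrow> 's \<Rightarrow> 's) \<Rightarrow> 's \<Rightarrow> 's option set" where
  "PP1 S m a = insert (one1 S m) (Some ` PP S m a)"

definition c_conjugate :: "'s set \<Rightarrow> ('s \<Rightarrow> 's \<Rightarrow> 's) \<Rightarrow> 's \<Rightarrow> 's \<Rightarrow> bool" where
  "c_conjugate S m a b \<longleftrightarrow> a \<in> S \<and> b \<in> S \<and>
    (\<exists>g\<in>PP1 S m a. \<exists>h\<in>PP1 S m b.
       mult1 m (Some a) g = mult1 m g (Some b) \<and>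
       mult1 m (Some b) h = mult1 m h (Some a))"

text \<open>
  Partial maps on \<open>X\<close> are of type \<open>'a \<rightharpoonup> 'a\<close>; full transformations of \<open>X\<close> are those with domain
  \<open>X\<close>, so that distinct elements of \<open>Gamma X\<close> differ on \<open>X\<close>.
\<close>

definition Gamma :: "'a set \<Rightarrow> ('a \<rightharpoonup> 'a) set" where
  "Gamma X = {\<alpha>. dom \<alpha> = X \<and> ran \<alpha> \<subseteq> X \<and> inj_on \<alpha> X}"

text \<open>
  Maps act on the right: the product \<open>\<alpha>\<beta>\<close> applies \<open>\<alpha>\<close> first.
\<close>

definition comp_lr :: "('a \<rightharpoonup> 'a) \<Rightarrow> ('a \<rightharpoonup> 'a) \<Rightarrow> ('a \<rightharpoonup> 'a)" where
  "comp_lr \<alpha> \<beta> = \<beta> \<circ>\<^sub>m \<alpha>"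

lemma comp_lr_Gamma:
  assumes "\<alpha> \<in> Gamma X" "\<beta> \<in> Gamma X"
  shows "comp_lr \<alpha> \<beta> \<in> Gamma X"
proof -
  have \<alpha>: "dom \<alpha> = X" "ran \<alpha> \<subseteq> X" "inj_on \<alpha> X" and \<beta>: "dom \<beta> = X" "ran \<beta> \<subseteq> X" "inj_on \<beta> X"
    using assms unfolding Gamma_def by simp_all
  have val: "\<exists>u\<in>X. \<alpha> x = Some u" if x: "x \<in> X" for x
  proof -
    from x \<alpha>(1) obtain u where u: "\<alpha> x = Some u" by blast
    then have "u \<in> X" using \<alpha>(2) ranI by fast
    with u show ?thesis by blast
  qed
  have "dom (comp_lr \<alpha> \<beta>) = X"
  proof (intro set_eqI iffI)
    fix x assume "x \<in> dom (comp_lr \<alpha> \<beta>)"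
    then have "x \<in> dom \<alpha>" by (auto simp: comp_lr_def map_comp_Some_iff)
    then show "x \<in> X" by (simp only: \<alpha>(1))
  next
    fix x assume "x \<in> X"
    then obtain u where u: "u \<in> X" "\<alpha> x = Some u" using val by blast
    then obtain v where "\<beta> u = Some v" using \<beta>(1) by blast
    with u show "x \<in> dom (comp_lr \<alpha> \<beta>)" by (simp add: comp_lr_def domI)
  qed
  moreover have "ran (comp_lr \<alpha> \<beta>) \<subseteq> X"
  proof
    fix y assume "y \<in> ran (comp_lr \<alpha> \<beta>)"
    then have "y \<in> ran \<beta>" by (auto simp: comp_lr_def map_comp_Some_iff ran_def)
    with \<beta>(2) show "y \<in> X" by (rule subsetD)
  qed
  moreover have "inj_on (comp_lr \<alpha> \<beta>) X"
  proof (rule inj_onI)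
    fix x y assume x: "x \<in> X" and y: "y \<in> X" and eq: "comp_lr \<alpha> \<beta> x = comp_lr \<alpha> \<beta> y"
    obtain u where u: "u \<in> X" "\<alpha> x = Some u" using val[OF x] by blast
    obtain v where v: "v \<in> X" "\<alpha> y = Some v" using val[OF y] by blast
    have "\<beta> u = \<beta> v" using eq u(2) v(2) by (simp add: comp_lr_def)
    then have "u = v" using inj_onD[OF \<beta>(3)] u(1) v(1) by simp
    then have "\<alpha> x = \<alpha> y" using u(2) v(2) by simp
    then show "x = y" using inj_onD[OF \<alpha>(3)] x y by simp
  qed
  ultimately show ?thesis by (simp add: Gamma_def)
qed

lemma comp_lr_assoc: "comp_lr (comp_lr \<alpha> \<beta>) \<gamma> = comp_lr \<alpha> (comp_lr \<beta> \<gamma>)"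
  by (rule ext) (simp add: comp_lr_def map_comp_def split: option.splits)

text \<open>
  In the three predicates below, \<open>x\<close> enumerates the points \<open>x\<^sub>i\<close> and \<open>\<sigma>\<close> is the partial map
  defined exactly by the displayed arrows.
\<close>

definition cycle_along :: "nat \<Rightarrow> (nat \<Rightarrow> 'a) \<Rightarrow> ('a \<rightharpoonup> 'a) \<Rightarrow> bool" where
  "cycle_along k x \<sigma> \<longleftrightarrow> k \<ge> 1 \<and> inj_on x {..<k} \<and> dom \<sigma> = x ` {..<k} \<and>
    (\<forall>i<k. \<sigma> (x i) = Some (x (Suc i mod k)))"

definition right_ray_along :: "(nat \<Rightarrow> 'a) \<Rightarrow> ('a \<rightharpoonup> 'a) \<Rightarrow> bool" where
  "right_ray_along x \<sigma> \<longleftrightarrow> inj x \<and> dom \<sigma> = range x \<and> (\<forall>i. \<sigma> (x i) = Some (x (Suc i)))"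

definition double_ray_along :: "(int \<Rightarrow> 'a) \<Rightarrow> ('a \<rightharpoonup> 'a) \<Rightarrow> bool" where
  "double_ray_along x \<sigma> \<longleftrightarrow> inj x \<and> dom \<sigma> = range x \<and> (\<forall>i. \<sigma> (x i) = Some (x (i + 1)))"

text \<open>
  The relation \<open>\<sigma> \<subseteq>\<^sub>m \<alpha>\<close> says that \<open>\<sigma>\<close> is contained in \<open>\<alpha>\<close>.
\<close>

definition max_right_rays :: "('a \<rightharpoonup> 'a) \<Rightarrow> ('a \<rightharpoonup> 'a) set" where
  "max_right_rays \<alpha> = {\<sigma>. \<exists>x. right_ray_along x \<sigma> \<and> \<sigma> \<subseteq>\<^sub>m \<alpha> \<and> x 0 \<notin> ran \<alpha>}"

definition double_rays :: "('a \<rightharpoonup> 'a) \<Rightarrow> ('a \<rightharpoonup> 'a) set" where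
  "double_rays \<alpha> = {\<sigma>. \<exists>x. double_ray_along x \<sigma> \<and> \<sigma> \<subseteq>\<^sub>m \<alpha>}"

definition cycles :: "nat \<Rightarrow> ('a \<rightharpoonup> 'a) \<Rightarrow> ('a \<rightharpoonup> 'a) set" where
  "cycles n \<alpha> = {\<sigma>. \<exists>x. cycle_along n x \<sigma> \<and> \<sigma> \<subseteq>\<^sub>m \<alpha>}"

end

theory Submission
  imports Defs
begin

text \<open>
  Since \<open>\<Gamma>(X)\<close> has no zero unless it is trivial, \<open>\<alpha> \<sim>\<^sub>c \<beta>\<close> says that each of the systems
  \<open>(X, \<alpha>)\<close> and \<open>(X, \<beta>)\<close> embeds equivariantly into the other. The maximal right rays, double
  rays and cycles of \<open>\<alpha>\<close> are exactly the restrictions of \<open>\<alpha>\<close> to the classes of the relation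
  \<open>x\<alpha>\<^sup>m = y\<alpha>\<^sup>n\<close>, and an embedding is injective on classes. It sends \<open>n\<close>-cycles to \<open>n\<close>-cycles, double
  rays to double rays, and right rays into right or double rays, so mutual embeddability gives the
  three equalities by Schroeder--Bernstein. Conversely the equalities give an injection from the
  classes of \<open>\<alpha>\<close> to those of \<open>\<beta>\<close> that preserves cycle lengths and double rays and takes
  right rays to right or double rays; embedding class by class yields an equivariant injection.
\<close>

subsection \<open>Cardinalities of disjoint unions\<close>

lemma card_of_disjoint_Un:
  assumes "A \<inter> B = {}"
  shows "|A \<union> B| =o |A| +c |B|"
proof -
  have "bij_betw (\<lambda>c. if c \<in> A then Inl c else Inr c) (A \<union> B) (A <+> B)"
    using assms by (auto simp: bij_betw_def inj_on_def image_iff)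
  then show ?thesis
    unfolding csum_def Field_card_of using card_of_ordIso by blast
qed

lemma card_of_Un_infinite_finite:
  assumes "infinite A" "finite B"
  shows "|A \<union> B| =o |A|"
proof -
  have le: "|B| \<le>o |A|"
    using assms by (metis card_of_Well_order card_of_ordLeq_finite ordLeq_total)
  have "|A \<union> B| \<le>o |A|"
    by (rule ordLeq_ordIso_trans[OF card_of_Un_Plus_ordLeq card_of_Plus_infinite1[OF assms(1) le]])
  then show ?thesis
    by (simp add: ordIso_iff_ordLeq card_of_mono1)
qed

text \<open>Later \<open>A\<close> holds the right rays and \<open>B\<close> the double rays of one
  map. If \<open>B\<close> is finite, it can be cancelled from the equality of unions, and two
  bijections are pasted together. If \<open>B\<close> is infinite, cancellation fails, but
  \<open>B'\<close> is as large as \<open>B' <+> B'\<close> and can absorb, besides a copy of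
  \<open>B\<close>, every element of \<open>A\<close> that a bijection of the unions sends into
  \<open>B'\<close>.\<close>

lemma inj_of_card_of_disjoint_Un:
  assumes disj: "A \<inter> B = {}" "A' \<inter> B' = {}"
    and Un: "|A \<union> B| =o |A' \<union> B'|" and B: "|B| =o |B'|"
  shows "\<exists>f. inj_on f (A \<union> B) \<and> f ` A \<subseteq> A' \<union> B' \<and> f ` B \<subseteq> B'"
proof (cases "finite B")
  case True
  then have fB': "finite B'" using B card_of_ordIso_finite by blast
  have fin: "finite (A \<union> B) = finite (A' \<union> B')" using Un by (rule card_of_ordIso_finite)
  \<comment> \<open>Cancelling the finite \<open>B\<close>: by counting when \<open>A\<close> is
    finite, and by absorption into \<open>A\<close> when it is infinite.\<close>
  have "|A| =o |A'|"
  proof (cases "finite A")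
    case fA: True
    then have fA': "finite A'" using True fin by simp
    obtain h where "bij_betw h (A \<union> B) (A' \<union> B')"
      using Un[folded card_of_ordIso] by (rule exE)
    moreover obtain k where "bij_betw k B B'"
      using B[folded card_of_ordIso] by (rule exE)
    ultimately have "card (A \<union> B) = card (A' \<union> B')" "card B = card B'"
      by (auto dest: bij_betw_same_card)
    then have "card A = card A'"
      using fA fA' True fB' disj by (simp add: card_Un_disjoint)
    then show ?thesis
      using finite_same_card_bij[OF fA fA'] card_of_ordIso[of A A'] by simp
  next
    case iA: False
    then have iA': "infinite A'" using fin fB' by simp
    show ?thesis
      using card_of_Un_infinite_finite[OF iA True] card_of_Un_infinite_finite[OF iA' fB'] Un
      by (meson ordIso_symmetric ordIso_transitive)
  qed
  then obtain h where h: "bij_betw h A A'" using card_of_ordIso by blast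
  obtain k where k: "bij_betw k B B'" using B card_of_ordIso by blast
  let ?f = "\<lambda>x. if x \<in> A then h x else k x"
  have hA: "\<And>x. x \<in> A \<Longrightarrow> h x \<in> A'" using h bij_betwE by blast
  have kB: "\<And>x. x \<in> B \<Longrightarrow> k x \<in> B'" using k bij_betwE by blast
  have "inj_on ?f (A \<union> B)"
  proof (rule inj_onI)
    fix x y assume xy: "x \<in> A \<union> B" "y \<in> A \<union> B" and eq: "?f x = ?f y"
    \<comment> \<open>Whether a value lies in \<open>A'\<close> reveals which of the two bijections
      produced it.\<close>
    have *: "?f z \<in> A' \<longleftrightarrow> z \<in> A" if "z \<in> A \<union> B" for z
      using that hA[of z] kB[of z] disj(2) by auto
    have same: "x \<in> A \<longleftrightarrow> y \<in> A" using *[OF xy(1)] *[OF xy(2)] eq by metis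
    show "x = y"
    proof (cases "x \<in> A")
      case True
      then show ?thesis using same eq bij_betw_imp_inj_on[OF h] by (simp add: inj_on_def)
    next
      case False
      then show ?thesis using xy same eq bij_betw_imp_inj_on[OF k] by (simp add: inj_on_def)
    qed
  qed
  moreover have "?f ` A \<subseteq> A' \<union> B'" using hA by auto
  moreover have "?f ` B \<subseteq> B'" using kB disj by auto
  ultimately show ?thesis by blast
next
  case False
  then have iB': "infinite B'" using B card_of_ordIso_finite by blast
  obtain p where p: "bij_betw p B B'" using B card_of_ordIso by blast
  obtain h where h: "bij_betw h (A \<union> B) (A' \<union> B')" using Un card_of_ordIso by blast
  obtain k where k: "bij_betw k (B' <+> B') B'"
    using card_of_Plus_infinite1[OF iB' card_of_mono1[OF subset_refl]] card_of_ordIso by blast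
  \<comment> \<open>The left summand receives \<open>B\<close>, the right one those points of
    \<open>A\<close> that \<open>h\<close> sends into \<open>B'\<close>; the remaining points of
    \<open>A\<close> keep their \<open>h\<close>-values, which lie outside \<open>B'\<close>. Hence
    the three kinds of values cannot collide.\<close>
  let ?f = "\<lambda>x. if x \<in> B then k (Inl (p x)) else if h x \<in> B' then k (Inr (h x)) else h x"
  have kE: "\<And>z. z \<in> B' <+> B' \<Longrightarrow> k z \<in> B'" using k bij_betwE by blast
  have kI: "\<And>z w. z \<in> B' <+> B' \<Longrightarrow> w \<in> B' <+> B' \<Longrightarrow> k z = k w \<Longrightarrow> z = w"
    using k by (meson bij_betw_imp_inj_on inj_onD)
  have pE: "\<And>x. x \<in> B \<Longrightarrow> p x \<in> B'" using p bij_betwE by blast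
  have pI: "\<And>x y. x \<in> B \<Longrightarrow> y \<in> B \<Longrightarrow> p x = p y \<Longrightarrow> x = y"
    using p by (meson bij_betw_imp_inj_on inj_onD)
  have hE: "\<And>x. x \<in> A \<Longrightarrow> h x \<in> A' \<union> B'" using h bij_betwE by blast
  have hI: "\<And>x y. x \<in> A \<Longrightarrow> y \<in> A \<Longrightarrow> h x = h y \<Longrightarrow> x = y"
    using h by (meson UnI1 bij_betw_imp_inj_on inj_onD)
  have inl: "k (Inl (p x)) \<in> B'" if "x \<in> B" for x using kE pE that by blast
  have inr: "k (Inr u) \<in> B'" if "u \<in> B'" for u using kE that by blast
  have "inj_on ?f (A \<union> B)"
  proof (rule inj_onI)
    fix x y assume x: "x \<in> A \<union> B" and y: "y \<in> A \<union> B" and eq: "?f x = ?f y"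
    consider "x \<in> B" "y \<in> B" | "x \<in> B" "y \<in> A" "y \<notin> B" | "x \<in> A" "x \<notin> B" "y \<in> B"
      | "x \<in> A" "x \<notin> B" "y \<in> A" "y \<notin> B" using x y by blast
    then show "x = y"
    proof cases
      case 1
      then have "Inl (p x) = (Inl (p y) :: 'b + 'b)"
        using eq pE by (intro kI) auto
      then show ?thesis using 1 pI by blast
    next
      case 2
      show ?thesis
      proof (cases "h y \<in> B'")
        case True
        then have "Inl (p x) = Inr (h y)" using 2 eq pE by (intro kI) auto
        then show ?thesis by simp
      next
        case False
        then show ?thesis using 2 eq inl[of x] by simp
      qed
    next
      case 3
      show ?thesis
      proof (cases "h x \<in> B'")
        case True
        then have "Inr (h x) = Inl (p y)" using 3 eq pE by (intro kI) auto
        then show ?thesis by simp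
      next
        case False
        then show ?thesis using 3 eq inl[of y] by simp
      qed
    next
      case 4
      have "h x = h y"
      proof (cases "h x \<in> B'"; cases "h y \<in> B'")
        assume *: "h x \<in> B'" "h y \<in> B'"
        then have "Inr (h x) = (Inr (h y) :: 'b + 'b)" using 4 eq by (intro kI) auto
        then show ?thesis by simp
      qed (use 4 eq inr[of "h x"] inr[of "h y"] in simp_all)
      then show ?thesis using 4 hI by blast
    qed
  qed
  moreover have "?f ` A \<subseteq> A' \<union> B'" using hE inl inr by auto
  moreover have "?f ` B \<subseteq> B'" using inl by auto
  ultimately show ?thesis by blast
qed

subsection \<open>Conjugacy as mutual embeddability\<close>

text \<open>Made total so that iterates can be written with \<open>^^\<close>; outside the domain
  the value is the unspecified \<open>the None\<close>.\<close>

definition step :: "('a \<rightharpoonup> 'a) \<Rightarrow> 'a \<Rightarrow> 'a" where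
  "step \<alpha> x = the (\<alpha> x)"

definition equivariant_embedding :: "'a set \<Rightarrow> ('a \<rightharpoonup> 'a) \<Rightarrow> ('a \<rightharpoonup> 'a) \<Rightarrow> ('a \<Rightarrow> 'a) \<Rightarrow> bool" where
  "equivariant_embedding X \<alpha> \<beta> g \<longleftrightarrow>
    inj_on g X \<and> g ` X \<subseteq> X \<and> (\<forall>x\<in>X. g (step \<alpha> x) = step \<beta> (g x))"

lemma Gamma_step:
  assumes "\<alpha> \<in> Gamma X"
  shows "x \<in> X \<Longrightarrow> \<alpha> x = Some (step \<alpha> x)" "x \<in> X \<Longrightarrow> step \<alpha> x \<in> X" "inj_on (step \<alpha>) X"
    "x \<notin> X \<Longrightarrow> \<alpha> x = None"
proof -
  have d: "dom \<alpha> = X" and r: "ran \<alpha> \<subseteq> X" and i: "inj_on \<alpha> X" using assms by (auto simp: Gamma_def)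
  show 1: "\<alpha> x = Some (step \<alpha> x)" if "x \<in> X" for x using that d by (auto simp: step_def)
  show "step \<alpha> x \<in> X" if "x \<in> X" using 1[OF that] r by (auto simp: ran_def)
  show "inj_on (step \<alpha>) X" using i 1 by (auto simp: inj_on_def)
  show "x \<notin> X \<Longrightarrow> \<alpha> x = None" using d by blast
qed

lemma Gamma_ran:
  assumes "\<alpha> \<in> Gamma X"
  shows "ran \<alpha> = step \<alpha> ` X"
proof -
  have "\<alpha> x = Some y \<longleftrightarrow> x \<in> X \<and> y = step \<alpha> x" for x y
    using Gamma_step(1,4)[OF assms, of x] by (cases "x \<in> X") auto
  then show ?thesis by (auto simp: ran_def)
qed

text \<open>A translation between partial and total maps: one direction passes to
  \<open>step g\<close>, the other cuts \<open>g\<close> down to \<open>X\<close> with the value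
  \<open>None\<close> elsewhere.\<close>

lemma ex_Gamma_intertwiner_iff:
  assumes \<alpha>: "\<alpha> \<in> Gamma X" and \<beta>: "\<beta> \<in> Gamma X"
  shows "(\<exists>g\<in>Gamma X. comp_lr \<alpha> g = comp_lr g \<beta>) \<longleftrightarrow> (\<exists>g. equivariant_embedding X \<alpha> \<beta> g)"
proof
  assume "\<exists>g\<in>Gamma X. comp_lr \<alpha> g = comp_lr g \<beta>"
  then obtain g where g: "g \<in> Gamma X" and eq: "comp_lr \<alpha> g = comp_lr g \<beta>" by blast
  have "step g (step \<alpha> x) = step \<beta> (step g x)" if x: "x \<in> X" for x
    using fun_cong[OF eq, of x] x
    by (simp add: comp_lr_def Gamma_step[OF \<alpha>] Gamma_step[OF \<beta>] Gamma_step[OF g])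
  then have "equivariant_embedding X \<alpha> \<beta> (step g)"
    using Gamma_step[OF g] by (auto simp: equivariant_embedding_def)
  then show "\<exists>g. equivariant_embedding X \<alpha> \<beta> g" by blast
next
  assume "\<exists>g. equivariant_embedding X \<alpha> \<beta> g"
  then obtain g where g: "inj_on g X" "g ` X \<subseteq> X" "\<And>x. x \<in> X \<Longrightarrow> g (step \<alpha> x) = step \<beta> (g x)"
    by (auto simp: equivariant_embedding_def)
  let ?g = "\<lambda>x. if x \<in> X then Some (g x) else None"
  have "?g \<in> Gamma X" using g by (auto simp: Gamma_def inj_on_def ran_def split: if_splits)
  moreover have "comp_lr \<alpha> ?g = comp_lr ?g \<beta>"
  proof
    fix x
    show "comp_lr \<alpha> ?g x = comp_lr ?g \<beta> x"
      using g by (cases "x \<in> X") (auto simp: comp_lr_def map_comp_def Gamma_step[OF \<alpha>] Gamma_step[OF \<beta>])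
  qed
  ultimately show "\<exists>g\<in>Gamma X. comp_lr \<alpha> g = comp_lr g \<beta>" by blast
qed

text \<open>The identity map of \<open>X\<close> lies in \<open>Gamma X\<close>, so the 1 in
  \<open>PP1\<close> is again a map in \<open>Gamma X\<close>.\<close>

lemma Gamma_one1:
  obtains e where "e \<in> Gamma X" "one1 (Gamma X) comp_lr = Some e"
    "\<And>\<alpha>. \<alpha> \<in> Gamma X \<Longrightarrow> comp_lr e \<alpha> = \<alpha> \<and> comp_lr \<alpha> e = \<alpha>"
proof -
  let ?S = "Gamma X" and ?i = "\<lambda>x. if x \<in> X then Some x else None"
  have ex: "is_identity ?S comp_lr ?i"
  proof -
    have "?i \<in> ?S" by (auto simp: Gamma_def inj_on_def ran_def split: if_splits)
    moreover have "comp_lr ?i \<alpha> = \<alpha> \<and> comp_lr \<alpha> ?i = \<alpha>" if "\<alpha> \<in> ?S" for \<alpha>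
    proof -
      have "\<alpha> x = comp_lr ?i \<alpha> x \<and> \<alpha> x = comp_lr \<alpha> ?i x" for x
        using Gamma_step[OF that] by (cases "x \<in> X") (simp_all add: comp_lr_def map_comp_def)
      then show ?thesis by (intro conjI ext) metis+
    qed
    ultimately show ?thesis by (simp add: is_identity_def)
  qed
  have uniq: "d = e" if "is_identity ?S comp_lr d" "is_identity ?S comp_lr e" for d e
    using that by (metis is_identity_def)
  let ?e = "THE e. is_identity ?S comp_lr e"
  have "is_identity ?S comp_lr ?e" by (rule theI[of _ ?i]) (use ex uniq in blast)+
  moreover have "one1 ?S comp_lr = Some ?e" using ex by (auto simp: one1_def)
  ultimately show ?thesis using that[of ?e] by (simp add: is_identity_def)
qed

text \<open>The equation \<alpha>z = z says that z takes the same value at x\<alpha> and at x, and z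
  is injective. So a zero leaves room only for the identity map.\<close>

lemma Gamma_zero_trivial:
  assumes z: "is_zero (Gamma X) comp_lr z" and \<alpha>: "\<alpha> \<in> Gamma X" and x: "x \<in> X"
  shows "\<alpha> x = Some x"
proof -
  have zG: "z \<in> Gamma X" and eq: "comp_lr \<alpha> z = z" using z \<alpha> by (auto simp: is_zero_def)
  have "step z (step \<alpha> x) = step z x"
    using fun_cong[OF eq, of x] x by (simp add: comp_lr_def Gamma_step[OF \<alpha>] Gamma_step[OF zG])
  then have "step \<alpha> x = x"
    using inj_onD[OF Gamma_step(3)[OF zG]] Gamma_step(2)[OF \<alpha>] x by blast
  then show ?thesis using Gamma_step(1)[OF \<alpha> x] by simp
qed

text \<open>The split follows the definition of \<open>PP\<close>. With a zero,
  \<open>\<alpha>\<close> and \<open>\<beta>\<close> coincide and both sides hold by identity maps.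
  Without one, \<open>PP1\<close> is all of \<open>Gamma X\<close>, so only the two intertwining
  equations remain.\<close>

lemma c_conjugate_Gamma_iff:
  assumes \<alpha>: "\<alpha> \<in> Gamma X" and \<beta>: "\<beta> \<in> Gamma X"
  shows "c_conjugate (Gamma X) comp_lr \<alpha> \<beta> \<longleftrightarrow>
    (\<exists>g. equivariant_embedding X \<alpha> \<beta> g) \<and> (\<exists>h. equivariant_embedding X \<beta> \<alpha> h)"
proof -
  obtain e where e: "e \<in> Gamma X" "one1 (Gamma X) comp_lr = Some e"
    "\<And>\<alpha>. \<alpha> \<in> Gamma X \<Longrightarrow> comp_lr e \<alpha> = \<alpha> \<and> comp_lr \<alpha> e = \<alpha>"
    by (rule Gamma_one1[where X = X]) blast
  show ?thesis
  proof (cases "\<exists>z. is_zero (Gamma X) comp_lr z")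
    case True
    then obtain z where "is_zero (Gamma X) comp_lr z" by blast
    from Gamma_zero_trivial[OF this] have "\<alpha> = \<beta>"
      using \<alpha> \<beta> Gamma_step(4) by (metis ext)
    moreover have "c_conjugate (Gamma X) comp_lr \<alpha> \<alpha>"
      using e \<alpha> by (auto simp: c_conjugate_def PP1_def)
    moreover have "equivariant_embedding X \<alpha> \<alpha> id" by (simp add: equivariant_embedding_def)
    ultimately show ?thesis by blast
  next
    case False
    then have "PP1 (Gamma X) comp_lr \<gamma> = Some ` Gamma X" for \<gamma>
      using e by (auto simp: PP1_def PP_def)
    then have "c_conjugate (Gamma X) comp_lr \<alpha> \<beta> \<longleftrightarrow>
      (\<exists>g\<in>Gamma X. comp_lr \<alpha> g = comp_lr g \<beta>) \<and> (\<exists>h\<in>Gamma X. comp_lr \<beta> h = comp_lr h \<alpha>)"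
      using \<alpha> \<beta> by (auto simp: c_conjugate_def)
    then show ?thesis
      by (simp add: ex_Gamma_intertwiner_iff[OF \<alpha> \<beta>] ex_Gamma_intertwiner_iff[OF \<beta> \<alpha>])
  qed
qed

subsection \<open>Components\<close>

text \<open>The grand orbit: all points whose forward orbit meets that of \<open>x\<close>. It is
  the connected component of \<open>x\<close> in the graph of \<open>\<alpha>\<close>.\<close>

definition orb :: "('a \<rightharpoonup> 'a) \<Rightarrow> 'a \<Rightarrow> 'a set" where
  "orb \<alpha> x = {y \<in> dom \<alpha>. \<exists>m n. (step \<alpha> ^^ m) x = (step \<alpha> ^^ n) y}"

text \<open>A partial map rather than a set of points, so that it can be equal to a ray or a
  cycle.\<close>

definition component :: "('a \<rightharpoonup> 'a) \<Rightarrow> 'a \<Rightarrow> ('a \<rightharpoonup> 'a)" where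
  "component \<alpha> x = \<alpha> |` orb \<alpha> x"

definition aperiodic :: "('a \<rightharpoonup> 'a) \<Rightarrow> 'a \<Rightarrow> bool" where
  "aperiodic \<alpha> x \<longleftrightarrow> (\<forall>n>0. (step \<alpha> ^^ n) x \<noteq> x)"

definition has_period :: "('a \<rightharpoonup> 'a) \<Rightarrow> nat \<Rightarrow> 'a \<Rightarrow> bool" where
  "has_period \<alpha> n x \<longleftrightarrow> 0 < n \<and> (step \<alpha> ^^ n) x = x \<and> (\<forall>m. 0 < m \<and> m < n \<longrightarrow> (step \<alpha> ^^ m) x \<noteq> x)"

text \<open>Ancestors are demanded for each \<open>n\<close> separately. For an injective map they
  are unique and therefore fit together into one backward chain.\<close>

definition has_ancestors :: "'a set \<Rightarrow> ('a \<rightharpoonup> 'a) \<Rightarrow> 'a \<Rightarrow> bool" where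
  "has_ancestors X \<alpha> x \<longleftrightarrow> (\<forall>n. \<exists>y\<in>X. (step \<alpha> ^^ n) y = x)"

lemma iter_in:
  assumes "\<alpha> \<in> Gamma X" "x \<in> X"
  shows "(step \<alpha> ^^ n) x \<in> X"
  using assms(2) by (induction n) (simp_all add: Gamma_step(2)[OF assms(1)])

lemma iter_inj:
  assumes "\<alpha> \<in> Gamma X" "x \<in> X" "y \<in> X" "(step \<alpha> ^^ n) x = (step \<alpha> ^^ n) y"
  shows "x = y"
  using assms(4)
proof (induction n)
  case (Suc n)
  then have "(step \<alpha> ^^ n) x = (step \<alpha> ^^ n) y"
    using inj_onD[OF Gamma_step(3)[OF assms(1)]] iter_in[OF assms(1)] assms(2,3) by simp
  then show ?case by (rule Suc.IH)
qed simp

lemma iter_cancel: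
  assumes "\<alpha> \<in> Gamma X" "x \<in> X" "y \<in> X" "(step \<alpha> ^^ i) x = (step \<alpha> ^^ (j + i)) y"
  shows "x = (step \<alpha> ^^ j) y"
proof (rule iter_inj[OF assms(1,2)])
  show "(step \<alpha> ^^ j) y \<in> X" by (rule iter_in[OF assms(1,3)])
  show "(step \<alpha> ^^ i) x = (step \<alpha> ^^ i) ((step \<alpha> ^^ j) y)"
    using assms(4) by (metis add.commute comp_apply funpow_add)
qed

lemma orb_eq_iff:
  assumes "x \<in> dom \<alpha>" "y \<in> dom \<alpha>"
  shows "orb \<alpha> x = orb \<alpha> y \<longleftrightarrow> (\<exists>m n. (step \<alpha> ^^ m) x = (step \<alpha> ^^ n) y)"
proof
  assume "orb \<alpha> x = orb \<alpha> y"
  moreover have "y \<in> orb \<alpha> y" using assms unfolding orb_def by blast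
  ultimately have "y \<in> orb \<alpha> x" by simp
  then show "\<exists>m n. (step \<alpha> ^^ m) x = (step \<alpha> ^^ n) y" unfolding orb_def by blast
next
  \<comment> \<open>Transitivity: advance the first meeting point by \<open>p\<close> steps and the
    second by \<open>n\<close> steps; since iterates commute, both reach the same iterate of
    \<open>v\<close>.\<close>
  have trans: "\<exists>m n. (step \<alpha> ^^ m) u = (step \<alpha> ^^ n) w"
    if "(step \<alpha> ^^ m) u = (step \<alpha> ^^ n) v" "(step \<alpha> ^^ p) v = (step \<alpha> ^^ q) w" for m n p q u v w
  proof -
    have "(step \<alpha> ^^ (p + m)) u = (step \<alpha> ^^ (p + n)) v" using that by (simp add: funpow_add)
    also have "\<dots> = (step \<alpha> ^^ (n + q)) w" using that by (simp add: add.commute[of p n] funpow_add)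
    finally show ?thesis by blast
  qed
  assume "\<exists>m n. (step \<alpha> ^^ m) x = (step \<alpha> ^^ n) y"
  then obtain m n where "(step \<alpha> ^^ m) x = (step \<alpha> ^^ n) y" by blast
  then show "orb \<alpha> x = orb \<alpha> y"
    unfolding orb_def using trans[of m x n y] trans[of n y m x] by fastforce
qed

text \<open>The orbit can be recovered from the component as its domain, so comparing components
  amounts to comparing orbits.\<close>

lemma component_eq_iff:
  assumes \<alpha>: "\<alpha> \<in> Gamma X" and "x \<in> X" "y \<in> X"
  shows "component \<alpha> x = component \<alpha> y \<longleftrightarrow> (\<exists>m n. (step \<alpha> ^^ m) x = (step \<alpha> ^^ n) y)"
proof -
  have d: "dom \<alpha> = X" using \<alpha> by (simp add: Gamma_def)
  have "dom (component \<alpha> z) = orb \<alpha> z" for z by (auto simp: component_def orb_def)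
  then have "component \<alpha> x = component \<alpha> y \<longleftrightarrow> orb \<alpha> x = orb \<alpha> y" by (metis component_def)
  then show ?thesis using orb_eq_iff[of x \<alpha> y] assms d by simp
qed

lemma dom_component_iff:
  assumes "\<alpha> \<in> Gamma X"
  shows "y \<in> dom (component \<alpha> x) \<longleftrightarrow> y \<in> X \<and> (\<exists>m n. (step \<alpha> ^^ m) x = (step \<alpha> ^^ n) y)"
  using assms unfolding component_def orb_def Gamma_def dom_restrict by blast

text \<open>Closure under images and preimages puts the whole orbit of \<open>p\<close> into the
  domain, and \<open>conn\<close> puts the domain into that orbit. The base point \<open>p\<close>
  is kept apart from \<open>x\<close> because connectedness is easiest to check from the origin of
  an enumeration.\<close>

lemma component_eqI:
  assumes \<alpha>: "\<alpha> \<in> Gamma X" and sub: "\<sigma> \<subseteq>\<^sub>m \<alpha>"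
    and fwd: "\<And>y. y \<in> dom \<sigma> \<Longrightarrow> step \<alpha> y \<in> dom \<sigma>"
    and bwd: "\<And>y. y \<in> X \<Longrightarrow> step \<alpha> y \<in> dom \<sigma> \<Longrightarrow> y \<in> dom \<sigma>"
    and p: "p \<in> dom \<sigma>"
    and conn: "\<And>y. y \<in> dom \<sigma> \<Longrightarrow> \<exists>m n. (step \<alpha> ^^ m) p = (step \<alpha> ^^ n) y"
    and x: "x \<in> dom \<sigma>"
  shows "\<sigma> = component \<alpha> x"
proof -
  have d: "dom \<alpha> = X" using \<alpha> by (simp add: Gamma_def)
  have sX: "dom \<sigma> \<subseteq> X" using map_le_implies_dom_le[OF sub] d by simp
  have fwd': "(step \<alpha> ^^ n) y \<in> dom \<sigma>" if "y \<in> dom \<sigma>" for n y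
    using that by (induction n) (simp_all only: funpow.simps id_apply comp_apply fwd)
  have bwd': "y \<in> dom \<sigma>" if "y \<in> X" "(step \<alpha> ^^ n) y \<in> dom \<sigma>" for n y
    using that
  proof (induction n)
    case (Suc n)
    then show ?case using bwd[OF iter_in[OF \<alpha> Suc.prems(1)]] by simp
  qed simp
  have "dom \<sigma> = orb \<alpha> p"
  proof (intro subset_antisym subsetI)
    fix y assume "y \<in> dom \<sigma>"
    then show "y \<in> orb \<alpha> p" using conn sX d unfolding orb_def by blast
  next
    fix y assume "y \<in> orb \<alpha> p"
    then obtain m n where y: "y \<in> X" "(step \<alpha> ^^ m) p = (step \<alpha> ^^ n) y"
      using d unfolding orb_def by blast
    have "(step \<alpha> ^^ n) y \<in> dom \<sigma>" unfolding y(2)[symmetric] by (rule fwd'[OF p])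
    then show "y \<in> dom \<sigma>" by (rule bwd'[OF y(1)])
  qed
  moreover have "orb \<alpha> x = orb \<alpha> p"
    using conn[OF x] orb_eq_iff[of p \<alpha> x] p x sX unfolding d by blast
  ultimately have "dom \<sigma> = orb \<alpha> x" by simp
  then show ?thesis
    using sub unfolding component_def map_le_def
    by (metis (no_types, opaque_lifting) domIff ext restrict_map_def)
qed

section \<open>Rays and cycles are components\<close>

lemma map_le_step: "\<sigma> \<subseteq>\<^sub>m \<alpha> \<Longrightarrow> \<sigma> x = Some y \<Longrightarrow> step \<alpha> x = y"
  by (metis domI map_le_def option.sel step_def)

text \<open>Backward closure is the point: injectivity leaves \<open>x j\<close> as the only
  preimage of \<open>x (Suc j)\<close>, and maximality denies \<open>x 0\<close> any
  preimage.\<close>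

lemma max_right_ray_eq_component:
  assumes \<alpha>: "\<alpha> \<in> Gamma X" and \<sigma>: "\<sigma> \<in> max_right_rays \<alpha>" and p: "p \<in> dom \<sigma>"
  shows "\<sigma> = component \<alpha> p"
proof -
  obtain x where x: "right_ray_along x \<sigma>" "\<sigma> \<subseteq>\<^sub>m \<alpha>" "x 0 \<notin> ran \<alpha>"
    using \<sigma> by (auto simp: max_right_rays_def)
  have dom: "dom \<sigma> = range x" and st: "step \<alpha> (x i) = x (Suc i)" for i
    using x map_le_step[OF x(2)] by (simp_all add: right_ray_along_def)
  have X: "x i \<in> X" for i
    using map_le_implies_dom_le[OF x(2)] dom \<alpha> by (auto simp: Gamma_def)
  have it: "(step \<alpha> ^^ i) (x 0) = x i" for i by (induction i) (simp_all add: st)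
  show ?thesis
  proof (rule component_eqI[OF \<alpha> x(2) _ _ _ _ p, of "x 0"])
    fix y assume y: "y \<in> X" "step \<alpha> y \<in> dom \<sigma>"
    then obtain i where i: "step \<alpha> y = x i" using dom by blast
    show "y \<in> dom \<sigma>"
    proof (cases i)
      case 0
      then show ?thesis using x(3) i y Gamma_ran[OF \<alpha>] by (metis imageI)
    next
      case (Suc j)
      then have "y = x j" using i st[of j] y X inj_onD[OF Gamma_step(3)[OF \<alpha>]] by metis
      then show ?thesis using dom by simp
    qed
  next
    fix y assume "y \<in> dom \<sigma>"
    then obtain i where "y = x i" using dom by blast
    then have "(step \<alpha> ^^ i) (x 0) = (step \<alpha> ^^ 0) y" using it by simp
    then show "\<exists>m n. (step \<alpha> ^^ m) (x 0) = (step \<alpha> ^^ n) y" by blast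
  qed (use dom st in auto)
qed

lemma double_ray_iter:
  fixes x :: "int \<Rightarrow> 'a"
  assumes "\<And>i. step \<alpha> (x i) = x (i + 1)"
  shows "(step \<alpha> ^^ n) (x i) = x (i + int n)"
  by (induction n) (simp_all add: assms add_ac)

lemma double_ray_eq_component:
  assumes \<alpha>: "\<alpha> \<in> Gamma X" and \<sigma>: "\<sigma> \<in> double_rays \<alpha>" and p: "p \<in> dom \<sigma>"
  shows "\<sigma> = component \<alpha> p"
proof -
  obtain x where x: "double_ray_along x \<sigma>" "\<sigma> \<subseteq>\<^sub>m \<alpha>"
    using \<sigma> by (auto simp: double_rays_def)
  have dom: "dom \<sigma> = range x" and st: "step \<alpha> (x i) = x (i + 1)" for i
    using x map_le_step[OF x(2)] by (simp_all add: double_ray_along_def)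
  have X: "x i \<in> X" for i
    using map_le_implies_dom_le[OF x(2)] dom \<alpha> by (auto simp: Gamma_def)
  note it = double_ray_iter[of \<alpha> x, OF st]
  show ?thesis
  proof (rule component_eqI[OF \<alpha> x(2) _ _ _ _ p, of "x 0"])
    fix y assume y: "y \<in> X" "step \<alpha> y \<in> dom \<sigma>"
    then obtain i where i: "step \<alpha> y = x i" using dom by blast
    then have "step \<alpha> y = step \<alpha> (x (i - 1))" using st[of "i - 1"] by simp
    then have "y = x (i - 1)" using y X inj_onD[OF Gamma_step(3)[OF \<alpha>]] by metis
    then show "y \<in> dom \<sigma>" using dom by simp
  next
    fix y assume "y \<in> dom \<sigma>"
    then obtain i where i: "y = x i" using dom by blast
    \<comment> \<open>Since \<open>nat\<close> sends negative integers to 0, one exponent is 0, and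
      the two orbits meet at the larger of the indices 0 and \<open>i\<close>.\<close>
    have "(step \<alpha> ^^ nat i) (x 0) = (step \<alpha> ^^ nat (- i)) y" unfolding i it by (cases "i \<ge> 0") simp_all
    then show "\<exists>m n. (step \<alpha> ^^ m) (x 0) = (step \<alpha> ^^ n) y" by blast
  qed (use dom st in auto)
qed

lemma cycle_iter:
  assumes "\<And>i. i < n \<Longrightarrow> step \<alpha> (x i) = x (Suc i mod n)" "i < n"
  shows "(step \<alpha> ^^ m) (x i) = x ((i + m) mod n)"
proof (induction m)
  case (Suc m)
  have "(i + m) mod n < n" using assms(2) by simp
  then show ?case using Suc assms(1) by (simp add: mod_Suc_eq)
qed (use assms(2) in simp)

lemma cycle_eq_component:
  assumes \<alpha>: "\<alpha> \<in> Gamma X" and \<sigma>: "\<sigma> \<in> cycles n \<alpha>" and p: "p \<in> dom \<sigma>"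
  shows "\<sigma> = component \<alpha> p"
proof -
  obtain x where x: "cycle_along n x \<sigma>" "\<sigma> \<subseteq>\<^sub>m \<alpha>"
    using \<sigma> by (auto simp: cycles_def)
  have n: "n > 0" and dom: "dom \<sigma> = x ` {..<n}" using x by (auto simp: cycle_along_def)
  have st: "step \<alpha> (x i) = x (Suc i mod n)" if "i < n" for i
    using x(1) map_le_step[OF x(2)] that by (simp add: cycle_along_def)
  have X: "x i \<in> X" if "i < n" for i
    using map_le_implies_dom_le[OF x(2)] dom \<alpha> that by (auto simp: Gamma_def)
  note it = cycle_iter[of n \<alpha> x, OF st]
  show ?thesis
  proof (rule component_eqI[OF \<alpha> x(2) _ _ _ _ p, of "x 0"])
    fix y assume y: "y \<in> X" "step \<alpha> y \<in> dom \<sigma>"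
    then obtain i where i: "step \<alpha> y = x i" "i < n" using dom by blast
    \<comment> \<open>The cyclic predecessor of \<open>i\<close>, written as a sum because
      \<open>i - 1\<close> would truncate at \<open>i = 0\<close>.\<close>
    let ?j = "(i + (n - 1)) mod n"
    have j: "?j < n" using n by simp
    have "Suc ?j mod n = i" using n i by (simp add: mod_Suc_eq)
    then have "step \<alpha> y = step \<alpha> (x ?j)" using st[OF j] i by simp
    then have "y = x ?j" using y X[OF j] inj_onD[OF Gamma_step(3)[OF \<alpha>]] by metis
    then show "y \<in> dom \<sigma>" using dom j by simp
  next
    fix y assume "y \<in> dom \<sigma>"
    then obtain i where i: "y = x i" "i < n" using dom by blast
    have "(step \<alpha> ^^ i) (x 0) = (step \<alpha> ^^ 0) y" using i it[of 0 i] n by simp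
    then show "\<exists>m n. (step \<alpha> ^^ m) (x 0) = (step \<alpha> ^^ n) y" by blast
  qed (use dom st n in auto)
qed

section \<open>The type of a component read off from one of its points\<close>

text \<open>The iterates of \<open>q\<close> are distinct: a repetition would cancel to an equation
  exhibiting \<open>q\<close> as an image. They form a maximal right ray through
  \<open>p\<close>.\<close>

lemma component_mem_max_right_rays:
  assumes \<alpha>: "\<alpha> \<in> Gamma X" and q: "q \<in> X" "q \<notin> ran \<alpha>" and p: "(step \<alpha> ^^ n) q = p"
  shows "component \<alpha> p \<in> max_right_rays \<alpha>"
proof -
  let ?x = "\<lambda>i. (step \<alpha> ^^ i) q"
  have X: "?x i \<in> X" for i by (rule iter_in[OF \<alpha> q(1)])
  have ne: "?x i \<noteq> ?x (Suc j + i)" for i j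
  proof
    assume "?x i = ?x (Suc j + i)"
    then have "q = ?x (Suc j)" using iter_cancel[OF \<alpha> q(1) q(1)] by blast
    then show False using q(2) X[of j] Gamma_ran[OF \<alpha>] by auto
  qed
  have inj: "inj ?x"
  proof (rule linorder_injI)
    fix i j :: nat assume "i < j"
    then obtain k where "j = Suc k + i" by (metis add_Suc less_natE add.commute)
    then show "?x i \<noteq> ?x j" using ne by simp
  qed
  let ?s = "\<alpha> |` range ?x"
  have "?s \<in> max_right_rays \<alpha>"
    unfolding max_right_rays_def right_ray_along_def
    using inj q(2) X Gamma_step(1)[OF \<alpha>]
    by (intro CollectI exI[of _ ?x]) (auto simp: map_le_def restrict_map_def dom_def)
  moreover have "p \<in> dom ?s" using p X[of n] Gamma_step(1)[OF \<alpha>] by (auto simp: dom_def)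
  ultimately show ?thesis using max_right_ray_eq_component[OF \<alpha>] by metis
qed

lemma component_mem_double_rays:
  assumes \<alpha>: "\<alpha> \<in> Gamma X" and p: "p \<in> X" "aperiodic \<alpha> p" "has_ancestors X \<alpha> p"
  shows "component \<alpha> p \<in> double_rays \<alpha>"
proof -
  obtain b where b: "\<And>n. b n \<in> X" "\<And>n. (step \<alpha> ^^ n) (b n) = p"
    using p(3) unfolding has_ancestors_def by metis
  \<comment> \<open>Forward iterates of \<open>p\<close> on the nonnegative side, chosen ancestors
    on the negative side. The ancestors were chosen independently, so injectivity is needed to see
    that \<open>step \<alpha>\<close> moves each one to the next.\<close>
  define x where "x i = (if i \<ge> 0 then (step \<alpha> ^^ nat i) p else b (nat (- i)))" for i :: int
  have X: "x i \<in> X" for i using b iter_in[OF \<alpha> p(1)] by (simp add: x_def)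
  have st: "step \<alpha> (x i) = x (i + 1)" for i
  proof (cases "i \<ge> 0")
    case True
    then show ?thesis by (simp add: x_def nat_add_distrib)
  next
    case False
    then obtain k where k: "i = - int (Suc k)" by (metis int_cases nle_le not_le of_nat_0_le_iff)
    have "(step \<alpha> ^^ k) (step \<alpha> (b (Suc k))) = (step \<alpha> ^^ k) (b k)"
      using b(2)[of "Suc k"] b(2)[of k] by (simp add: funpow_swap1)
    then have "step \<alpha> (b (Suc k)) = b k"
      using iter_inj[OF \<alpha> _ b(1)] Gamma_step(2)[OF \<alpha> b(1)] by blast
    \<comment> \<open>At \<open>k = 0\<close> the index reaches 0 and the other branch of
      \<open>x\<close> applies; both branches agree there because \<open>b 0 = p\<close>.\<close>
    moreover have "x (i + 1) = b k"
      using b(2)[of 0] by (cases "k = 0") (auto simp: x_def k)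
    moreover have "x i = b (Suc k)" by (simp add: x_def k nat_add_distrib)
    ultimately show ?thesis by simp
  qed
  note it = double_ray_iter[of \<alpha> x, OF st]
  have ne: "x i \<noteq> x j" if "i < j" for i j
  proof
    assume eq: "x i = x j"
    let ?d = "nat (j - i)"
    have "?d > 0" using that by simp
    \<comment> \<open>A repetition makes \<open>x i\<close> periodic. A common iterate of
      \<open>x i\<close> and \<open>p\<close> carries that period over to \<open>p\<close>, against
      aperiodicity.\<close>
    obtain m n where mn: "(step \<alpha> ^^ m) (x i) = (step \<alpha> ^^ n) p"
    proof (cases "i \<ge> 0")
      case True
      then show ?thesis using that[of 0 "nat i"] by (simp add: x_def)
    next
      case False
      then show ?thesis using that[of "nat (- i)" 0] it[of "nat (- i)" i] by (simp add: x_def)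
    qed
    have "x i = (step \<alpha> ^^ ?d) (x i)" using eq that it[of ?d i] by simp
    then have "(step \<alpha> ^^ m) (x i) = (step \<alpha> ^^ (?d + m)) (x i)"
      by (metis add.commute comp_apply funpow_add)
    then have "(step \<alpha> ^^ n) p = (step \<alpha> ^^ (?d + n)) p"
      using mn by (simp add: funpow_add)
    then have "p = (step \<alpha> ^^ ?d) p" using iter_cancel[OF \<alpha> p(1) p(1)] by blast
    then show False using p(2) \<open>?d > 0\<close> unfolding aperiodic_def by metis
  qed
  have inj: "inj x" by (rule linorder_injI) (rule ne)
  let ?s = "\<alpha> |` range x"
  have "?s \<in> double_rays \<alpha>"
    unfolding double_rays_def double_ray_along_def
    using inj X Gamma_step(1)[OF \<alpha>] st
    by (intro CollectI exI[of _ x]) (auto simp: map_le_def restrict_map_def dom_def)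
  moreover have "p = x 0" by (simp add: x_def)
  then have "p \<in> dom ?s" using Gamma_step(1)[OF \<alpha> p(1)] by (auto simp: dom_def)
  ultimately show ?thesis using double_ray_eq_component[OF \<alpha>] by metis
qed

lemma component_mem_cycles:
  assumes \<alpha>: "\<alpha> \<in> Gamma X" and p: "p \<in> X" "has_period \<alpha> n p"
  shows "component \<alpha> p \<in> cycles n \<alpha>"
proof -
  let ?x = "\<lambda>i. (step \<alpha> ^^ i) p"
  have n: "n > 0" "?x n = p" using p(2) by (auto simp: has_period_def)
  have X: "?x i \<in> X" for i by (rule iter_in[OF \<alpha> p(1)])
  have ne: "?x i \<noteq> ?x j" if "i < j" "j < n" for i j
  proof
    assume "?x i = ?x j"
    then have "p = ?x (j - i)" using iter_cancel[OF \<alpha> p(1) p(1), of i "j - i"] that by simp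
    moreover have "?x (j - i) \<noteq> p" using p(2) that unfolding has_period_def by simp
    ultimately show False by simp
  qed
  have inj: "inj_on ?x {..<n}"
    by (rule linorder_inj_onI') (use ne in auto)
  have st: "step \<alpha> (?x i) = ?x (Suc i mod n)" if "i < n" for i
    using that n by (cases "Suc i = n") auto
  let ?s = "\<alpha> |` (?x ` {..<n})"
  have "?s \<in> cycles n \<alpha>"
    unfolding cycles_def cycle_along_def
    using inj X Gamma_step(1)[OF \<alpha>] st n(1)
    by (intro CollectI exI[of _ ?x]) (auto simp: map_le_def restrict_map_def dom_def)
  moreover have "p = ?x 0" by simp
  then have "p \<in> ?x ` {..<n}" using n(1) by blast
  then have "p \<in> dom ?s" using Gamma_step(1)[OF \<alpha> p(1)] by (auto simp: dom_def)
  ultimately show ?thesis using cycle_eq_component[OF \<alpha>] by metis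
qed

text \<open>If ancestors run out, take the least depth \<open>n\<close> without one. It is positive,
  as \<open>p\<close> is its own ancestor at depth 0, and the ancestor \<open>q\<close> one level
  before has no preimage, so a maximal right ray starts at \<open>q\<close>.\<close>

lemma aperiodic_component:
  assumes \<alpha>: "\<alpha> \<in> Gamma X" and p: "p \<in> X" "aperiodic \<alpha> p"
  shows "component \<alpha> p \<in> max_right_rays \<alpha> \<union> double_rays \<alpha>"
proof (cases "has_ancestors X \<alpha> p")
  case True
  then show ?thesis using component_mem_double_rays[OF \<alpha> p] by blast
next
  case False
  define n where "n = (LEAST n. \<not> (\<exists>q\<in>X. (step \<alpha> ^^ n) q = p))"
  have ex: "\<exists>n. \<not> (\<exists>q\<in>X. (step \<alpha> ^^ n) q = p)" using False by (auto simp: has_ancestors_def)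
  have n: "\<not> (\<exists>q\<in>X. (step \<alpha> ^^ n) q = p)" unfolding n_def using LeastI_ex[OF ex] .
  then obtain k where k: "n = Suc k" using p(1) by (cases n) auto
  have "\<exists>q\<in>X. (step \<alpha> ^^ k) q = p"
    using not_less_Least[of k "\<lambda>n. \<not> (\<exists>q\<in>X. (step \<alpha> ^^ n) q = p)"] k
    unfolding n_def[symmetric] by simp
  then obtain q where q: "q \<in> X" "(step \<alpha> ^^ k) q = p" by blast
  have "q \<notin> ran \<alpha>"
  proof
    assume "q \<in> ran \<alpha>"
    then obtain r where "r \<in> X" "q = step \<alpha> r" using Gamma_ran[OF \<alpha>] by auto
    then have "(step \<alpha> ^^ n) r = p" using q k by (simp add: funpow_swap1)
    then show False using n \<open>r \<in> X\<close> by blast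
  qed
  then show ?thesis using component_mem_max_right_rays[OF \<alpha> q(1) _ q(2)] by blast
qed

lemma periodic_component:
  assumes \<alpha>: "\<alpha> \<in> Gamma X" and p: "p \<in> X" "\<not> aperiodic \<alpha> p"
  shows "\<exists>n\<ge>1. component \<alpha> p \<in> cycles n \<alpha>"
proof -
  define n where "n = (LEAST n. n > 0 \<and> (step \<alpha> ^^ n) p = p)"
  have ex: "\<exists>n. n > 0 \<and> (step \<alpha> ^^ n) p = p" using p(2) by (auto simp: aperiodic_def)
  have "n > 0 \<and> (step \<alpha> ^^ n) p = p" unfolding n_def by (rule LeastI_ex[OF ex])
  moreover have "(step \<alpha> ^^ m) p \<noteq> p" if "0 < m" "m < n" for m
    using not_less_Least[OF that(2)[unfolded n_def]] that(1) by blast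
  ultimately have "has_period \<alpha> n p" by (simp add: has_period_def)
  then show ?thesis using component_mem_cycles[OF \<alpha> p(1)] by (auto simp: has_period_def Suc_le_eq)
qed

section \<open>The sets of rays and cycles described by conditions on points\<close>

lemma double_rays_eq:
  assumes \<alpha>: "\<alpha> \<in> Gamma X"
  shows "double_rays \<alpha> = component \<alpha> ` {p \<in> X. aperiodic \<alpha> p \<and> has_ancestors X \<alpha> p}"
proof (intro subset_antisym subsetI)
  fix \<sigma> assume \<sigma>: "\<sigma> \<in> double_rays \<alpha>"
  then obtain x where x: "double_ray_along x \<sigma>" "\<sigma> \<subseteq>\<^sub>m \<alpha>" by (auto simp: double_rays_def)
  have dom: "dom \<sigma> = range x" and st: "step \<alpha> (x i) = x (i + 1)" and inj: "inj x" for i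
    using x map_le_step[OF x(2)] by (simp_all add: double_ray_along_def)
  have X: "x i \<in> X" for i
    using map_le_implies_dom_le[OF x(2)] dom \<alpha> by (auto simp: Gamma_def)
  note it = double_ray_iter[of \<alpha> x, OF st]
  have "aperiodic \<alpha> (x 0)" using inj by (auto simp: aperiodic_def it inj_eq)
  moreover have "has_ancestors X \<alpha> (x 0)"
  proof -
    have "(step \<alpha> ^^ n) (x (- int n)) = x 0" for n by (simp add: it)
    then show ?thesis using X unfolding has_ancestors_def by blast
  qed
  moreover have "\<sigma> = component \<alpha> (x 0)" using double_ray_eq_component[OF \<alpha> \<sigma>] dom by simp
  ultimately show "\<sigma> \<in> component \<alpha> ` {p \<in> X. aperiodic \<alpha> p \<and> has_ancestors X \<alpha> p}" using X by blast
qed (use component_mem_double_rays[OF \<alpha>] in blast)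

text \<open>Right rays are treated together with double rays because embeddings preserve
  aperiodicity but may give ancestors to a point that lacked them.\<close>

lemma max_right_rays_Un_double_rays_eq:
  assumes \<alpha>: "\<alpha> \<in> Gamma X"
  shows "max_right_rays \<alpha> \<union> double_rays \<alpha> = component \<alpha> ` {p \<in> X. aperiodic \<alpha> p}"
proof (intro subset_antisym)
  have "max_right_rays \<alpha> \<subseteq> component \<alpha> ` {p \<in> X. aperiodic \<alpha> p}"
  proof
    fix \<sigma> assume \<sigma>: "\<sigma> \<in> max_right_rays \<alpha>"
    then obtain x where x: "right_ray_along x \<sigma>" "\<sigma> \<subseteq>\<^sub>m \<alpha>" by (auto simp: max_right_rays_def)
    have dom: "dom \<sigma> = range x" and st: "step \<alpha> (x i) = x (Suc i)" and inj: "inj x" for i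
      using x map_le_step[OF x(2)] by (simp_all add: right_ray_along_def)
    have X: "x i \<in> X" for i
      using map_le_implies_dom_le[OF x(2)] dom \<alpha> by (auto simp: Gamma_def)
    have it: "(step \<alpha> ^^ i) (x 0) = x i" for i by (induction i) (simp_all add: st)
    have "aperiodic \<alpha> (x 0)" using inj by (auto simp: aperiodic_def it inj_eq)
    moreover have "\<sigma> = component \<alpha> (x 0)" using max_right_ray_eq_component[OF \<alpha> \<sigma>] dom by simp
    ultimately show "\<sigma> \<in> component \<alpha> ` {p \<in> X. aperiodic \<alpha> p}" using X by blast
  qed
  then show "max_right_rays \<alpha> \<union> double_rays \<alpha> \<subseteq> component \<alpha> ` {p \<in> X. aperiodic \<alpha> p}"
    using double_rays_eq[OF \<alpha>] by blast
  show "component \<alpha> ` {p \<in> X. aperiodic \<alpha> p} \<subseteq> max_right_rays \<alpha> \<union> double_rays \<alpha>"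
    using aperiodic_component[OF \<alpha>] by blast
qed

lemma cycles_eq:
  assumes \<alpha>: "\<alpha> \<in> Gamma X"
  shows "cycles n \<alpha> = component \<alpha> ` {p \<in> X. has_period \<alpha> n p}"
proof (intro subset_antisym subsetI)
  fix \<sigma> assume \<sigma>: "\<sigma> \<in> cycles n \<alpha>"
  then obtain x where x: "cycle_along n x \<sigma>" "\<sigma> \<subseteq>\<^sub>m \<alpha>" by (auto simp: cycles_def)
  have n: "n > 0" and dom: "dom \<sigma> = x ` {..<n}" and inj: "inj_on x {..<n}"
    using x by (auto simp: cycle_along_def)
  have st: "step \<alpha> (x i) = x (Suc i mod n)" if "i < n" for i
    using x(1) map_le_step[OF x(2)] that by (simp add: cycle_along_def)
  have X: "x 0 \<in> X"
    using map_le_implies_dom_le[OF x(2)] dom \<alpha> n by (auto simp: Gamma_def)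
  have it: "(step \<alpha> ^^ m) (x 0) = x (m mod n)" for m
    using cycle_iter[of n \<alpha> x 0, OF st] n by simp
  have "has_period \<alpha> n (x 0)" using n inj by (auto simp: has_period_def it inj_on_eq_iff)
  moreover have "\<sigma> = component \<alpha> (x 0)" using cycle_eq_component[OF \<alpha> \<sigma>] dom n by auto
  ultimately show "\<sigma> \<in> component \<alpha> ` {p \<in> X. has_period \<alpha> n p}" using X by blast
qed (use component_mem_cycles[OF \<alpha>] in blast)

text \<open>The origin of a maximal right ray would have a predecessor on the double ray.\<close>

lemma max_right_rays_double_rays_disjoint:
  assumes "\<alpha> \<in> Gamma X"
  shows "max_right_rays \<alpha> \<inter> double_rays \<alpha> = {}"
proof -
  have False if A: "\<sigma> \<in> max_right_rays \<alpha>" and B: "\<sigma> \<in> double_rays \<alpha>" for \<sigma>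
  proof -
    obtain x where x: "right_ray_along x \<sigma>" "x 0 \<notin> ran \<alpha>" using A by (auto simp: max_right_rays_def)
    obtain y where y: "double_ray_along y \<sigma>" "\<sigma> \<subseteq>\<^sub>m \<alpha>" using B by (auto simp: double_rays_def)
    have "x 0 \<in> dom \<sigma>" using x by (auto simp: right_ray_along_def)
    then obtain i where "x 0 = y i" using y by (auto simp: double_ray_along_def)
    moreover have "\<sigma> (y (i - 1)) = Some (y i)" using y by (auto simp: double_ray_along_def)
    then have "\<alpha> (y (i - 1)) = Some (y i)" using y(2) by (metis domI map_le_def)
    ultimately show False using x(2) by (auto intro: ranI)
  qed
  then show ?thesis by blast
qed

text \<open>Together with \<open>card_dom_cycle\<close>, this lets the size of the domain tell rays
  from cycles and give the length of a cycle.\<close>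

lemma infinite_dom_ray:
  assumes "\<sigma> \<in> max_right_rays \<alpha> \<union> double_rays \<alpha>"
  shows "infinite (dom \<sigma>)"
  using assms
proof
  assume "\<sigma> \<in> max_right_rays \<alpha>"
  then obtain x :: "nat \<Rightarrow> 'a" where "inj x" "dom \<sigma> = range x"
    by (auto simp: max_right_rays_def right_ray_along_def)
  then show ?thesis using finite_imageD infinite_UNIV_nat by metis
next
  assume "\<sigma> \<in> double_rays \<alpha>"
  then obtain x :: "int \<Rightarrow> 'a" where "inj x" "dom \<sigma> = range x"
    by (auto simp: double_rays_def double_ray_along_def)
  then show ?thesis using finite_imageD infinite_UNIV_int by metis
qed

lemma card_dom_cycle: "\<sigma> \<in> cycles n \<alpha> \<Longrightarrow> finite (dom \<sigma>) \<and> card (dom \<sigma>) = n"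
  by (auto simp: cycles_def cycle_along_def card_image)

section \<open>What an embedding preserves\<close>

lemma embedding_iter:
  assumes \<alpha>: "\<alpha> \<in> Gamma X" and g: "equivariant_embedding X \<alpha> \<beta> g" and x: "x \<in> X"
  shows "g ((step \<alpha> ^^ n) x) = (step \<beta> ^^ n) (g x)"
proof (induction n)
  case (Suc n)
  then show ?case using g iter_in[OF \<alpha> x, of n] by (simp add: equivariant_embedding_def)
qed simp

text \<open>Lying in one component, being aperiodic and having a given period are all statements
  about equations between iterates. Equivariance transports such equations, and injectivity reflects
  them.\<close>

lemma embedding_iter_eq_iff:
  assumes \<alpha>: "\<alpha> \<in> Gamma X" and g: "equivariant_embedding X \<alpha> \<beta> g" and x: "x \<in> X" and y: "y \<in> X"
  shows "(step \<beta> ^^ m) (g x) = (step \<beta> ^^ n) (g y) \<longleftrightarrow> (step \<alpha> ^^ m) x = (step \<alpha> ^^ n) y"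
proof -
  have "inj_on g X" using g by (simp add: equivariant_embedding_def)
  then show ?thesis
    using embedding_iter[OF \<alpha> g x, of m] embedding_iter[OF \<alpha> g y, of n]
      iter_in[OF \<alpha> x, of m] iter_in[OF \<alpha> y, of n] by (metis inj_on_eq_iff)
qed

text \<open>Each component is sent to the component of the image of a chosen representative in
  \<open>P\<close>. This is injective because orbits meeting after \<open>g\<close> already met
  before.\<close>

lemma embedding_card_of_components:
  assumes \<alpha>: "\<alpha> \<in> Gamma X" and \<beta>: "\<beta> \<in> Gamma X" and g: "equivariant_embedding X \<alpha> \<beta> g"
    and P: "P \<subseteq> X" "g ` P \<subseteq> Q"
  shows "|component \<alpha> ` P| \<le>o |component \<beta> ` Q|"
proof -
  let ?r = "inv_into P (component \<alpha>)"
  let ?F = "\<lambda>\<sigma>. component \<beta> (g (?r \<sigma>))"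
  have gX: "g ` X \<subseteq> X" using g by (simp add: equivariant_embedding_def)
  have r: "?r \<sigma> \<in> P" "component \<alpha> (?r \<sigma>) = \<sigma>" if "\<sigma> \<in> component \<alpha> ` P" for \<sigma>
    using that by (auto intro: inv_into_into f_inv_into_f)
  have "inj_on ?F (component \<alpha> ` P)"
  proof (rule inj_onI)
    fix \<sigma> \<tau> assume \<sigma>: "\<sigma> \<in> component \<alpha> ` P" and \<tau>: "\<tau> \<in> component \<alpha> ` P" and eq: "?F \<sigma> = ?F \<tau>"
    have X: "?r \<sigma> \<in> X" "?r \<tau> \<in> X" using r(1)[OF \<sigma>] r(1)[OF \<tau>] P(1) by blast+
    then have "g (?r \<sigma>) \<in> X" "g (?r \<tau>) \<in> X" using gX by blast+
    then have "component \<alpha> (?r \<sigma>) = component \<alpha> (?r \<tau>)"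
      using eq X component_eq_iff[OF \<beta>] component_eq_iff[OF \<alpha>] embedding_iter_eq_iff[OF \<alpha> g] by simp
    then show "\<sigma> = \<tau>" using r \<sigma> \<tau> by simp
  qed
  moreover have "?F ` (component \<alpha> ` P) \<subseteq> component \<beta> ` Q" using r(1) P(2) by blast
  ultimately show ?thesis using card_of_ordLeq by blast
qed

lemma embedding_card_of_invariants:
  assumes \<alpha>: "\<alpha> \<in> Gamma X" and \<beta>: "\<beta> \<in> Gamma X" and g: "equivariant_embedding X \<alpha> \<beta> g"
  shows "|max_right_rays \<alpha> \<union> double_rays \<alpha>| \<le>o |max_right_rays \<beta> \<union> double_rays \<beta>|"
    "|double_rays \<alpha>| \<le>o |double_rays \<beta>|"
    "|cycles n \<alpha>| \<le>o |cycles n \<beta>|"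
proof -
  have gX: "g x \<in> X" if "x \<in> X" for x using g that by (auto simp: equivariant_embedding_def)
  have fix_iff: "(step \<beta> ^^ m) (g x) = g x \<longleftrightarrow> (step \<alpha> ^^ m) x = x" if "x \<in> X" for m x
    using embedding_iter_eq_iff[OF \<alpha> g that that, of m 0] by simp
  \<comment> \<open>Only an implication: a right ray may be embedded into a double ray, where every
    point has ancestors.\<close>
  have anc: "has_ancestors X \<beta> (g x)" if "has_ancestors X \<alpha> x" for x
    using that gX embedding_iter[OF \<alpha> g] unfolding has_ancestors_def by metis
  show "|max_right_rays \<alpha> \<union> double_rays \<alpha>| \<le>o |max_right_rays \<beta> \<union> double_rays \<beta>|"
    unfolding max_right_rays_Un_double_rays_eq[OF \<alpha>] max_right_rays_Un_double_rays_eq[OF \<beta>]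
    by (rule embedding_card_of_components[OF \<alpha> \<beta> g]) (auto simp: gX aperiodic_def fix_iff)
  show "|double_rays \<alpha>| \<le>o |double_rays \<beta>|"
    unfolding double_rays_eq[OF \<alpha>] double_rays_eq[OF \<beta>]
    by (rule embedding_card_of_components[OF \<alpha> \<beta> g]) (auto simp: gX aperiodic_def fix_iff anc)
  show "|cycles n \<alpha>| \<le>o |cycles n \<beta>|"
    unfolding cycles_eq[OF \<alpha>] cycles_eq[OF \<beta>]
    by (rule embedding_card_of_components[OF \<alpha> \<beta> g]) (auto simp: gX has_period_def fix_iff)
qed

section \<open>Building an embedding from maps between components\<close>

definition components :: "('a \<rightharpoonup> 'a) \<Rightarrow> ('a \<rightharpoonup> 'a) set" where
  "components \<alpha> = max_right_rays \<alpha> \<union> double_rays \<alpha> \<union> (\<Union>n\<in>{1..}. cycles n \<alpha>)"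

lemma components_eq_component:
  assumes "\<alpha> \<in> Gamma X" "\<sigma> \<in> components \<alpha>" "p \<in> dom \<sigma>"
  shows "\<sigma> = component \<alpha> p"
  using assms(2) unfolding components_def
  by (elim UnE UN_E) (erule max_right_ray_eq_component[OF assms(1) _ assms(3)]
      | erule double_ray_eq_component[OF assms(1) _ assms(3)]
      | erule cycle_eq_component[OF assms(1) _ assms(3)])+

lemma component_in_components:
  assumes "\<alpha> \<in> Gamma X" "p \<in> X"
  shows "component \<alpha> p \<in> components \<alpha>"
proof (cases "aperiodic \<alpha> p")
  case True
  then show ?thesis using aperiodic_component[OF assms] by (simp add: components_def)
next
  case False
  then show ?thesis using periodic_component[OF assms] by (auto simp: components_def)
qed

definition local_embedding :: "('a \<rightharpoonup> 'a) \<Rightarrow> ('a \<rightharpoonup> 'a) \<Rightarrow> ('a \<Rightarrow> 'a) \<Rightarrow> bool" where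
  "local_embedding \<sigma> \<tau> g \<longleftrightarrow>
    inj_on g (dom \<sigma>) \<and> g ` dom \<sigma> \<subseteq> dom \<tau> \<and> (\<forall>x\<in>dom \<sigma>. \<tau> (g x) = Some (g (step \<sigma> x)))"

text \<open>Both maps act on their enumerations by the same index rule \<open>s\<close>, so
  \<open>x i\<close> can be sent to \<open>y i\<close>. The rule is \<open>Suc\<close> for right
  rays, adding 1 for double rays, and the cyclic successor for cycles.\<close>

lemma local_embedding_along:
  assumes "inj_on x I" "dom \<sigma> = x ` I" "inj_on y I"
    and s: "\<And>i. i \<in> I \<Longrightarrow> s i \<in> I" "\<And>i. i \<in> I \<Longrightarrow> \<sigma> (x i) = Some (x (s i))"
      "\<And>i. i \<in> I \<Longrightarrow> \<tau> (y i) = Some (y (s i))"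
  shows "\<exists>g. local_embedding \<sigma> \<tau> g"
proof
  let ?g = "\<lambda>z. y (inv_into I x z)"
  have g: "?g (x i) = y i" if "i \<in> I" for i using assms(1) that by simp
  have inj: "inj_on ?g (x ` I)" using assms(3) g by (auto simp: inj_on_def)
  have "\<tau> (?g z) = Some (?g (step \<sigma> z))" if "z \<in> dom \<sigma>" for z
    using that s g assms(2) by (auto simp: step_def)
  then show "local_embedding \<sigma> \<tau> ?g"
    using inj assms(2) by (auto simp: local_embedding_def)
qed

lemma max_right_ray_embeds:
  assumes "\<sigma> \<in> max_right_rays \<alpha>" "\<tau> \<in> max_right_rays \<beta> \<union> double_rays \<beta>"
  shows "\<exists>g. local_embedding \<sigma> \<tau> g"
proof -
  obtain x where x: "right_ray_along x \<sigma>" using assms by (auto simp: max_right_rays_def)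
  obtain y where y: "inj y" "\<And>i :: nat. \<tau> (y i) = Some (y (Suc i))"
  proof -
    consider y where "right_ray_along y \<tau>" | y where "double_ray_along y \<tau>"
      using assms by (auto simp: max_right_rays_def double_rays_def)
    then show ?thesis
    proof cases
      case 1
      then show ?thesis using that by (auto simp: right_ray_along_def)
    next
      case 2
      \<comment> \<open>The nonnegative half of a double ray serves as the target of a right
        ray.\<close>
      then have "inj (\<lambda>i. y (int i))" "\<And>i. \<tau> (y (int i)) = Some (y (int (Suc i)))"
        unfolding double_ray_along_def by (auto intro!: injI dest: injD simp: add.commute)
      then show ?thesis by (rule that)
    qed
  qed
  show ?thesis
    by (rule local_embedding_along[of x UNIV _ y Suc]) (use x y in \<open>auto simp: right_ray_along_def\<close>)
qed

lemma double_ray_embeds: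
  assumes "\<sigma> \<in> double_rays \<alpha>" "\<tau> \<in> double_rays \<beta>"
  shows "\<exists>g. local_embedding \<sigma> \<tau> g"
proof -
  obtain x y where "double_ray_along x \<sigma>" "double_ray_along y \<tau>"
    using assms by (auto simp: double_rays_def)
  then show ?thesis
    by (intro local_embedding_along[of x UNIV _ y "\<lambda>i. i + 1"]) (auto simp: double_ray_along_def)
qed

lemma cycle_embeds:
  assumes "\<sigma> \<in> cycles n \<alpha>" "\<tau> \<in> cycles n \<beta>"
  shows "\<exists>g. local_embedding \<sigma> \<tau> g"
proof -
  obtain x y where "cycle_along n x \<sigma>" "cycle_along n y \<tau>"
    using assms by (auto simp: cycles_def)
  then show ?thesis
    by (intro local_embedding_along[of x "{..<n}" _ y "\<lambda>i. Suc i mod n"]) (auto simp: cycle_along_def)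
qed

lemma components_map_le: "\<sigma> \<in> components \<alpha> \<Longrightarrow> \<sigma> \<subseteq>\<^sub>m \<alpha>"
  by (auto simp: components_def max_right_rays_def double_rays_def cycles_def)

text \<open>Every point is moved by the local embedding of its own component. An image point
  determines the component of \<open>\<beta>\<close> containing it, hence by injectivity of
  \<open>f\<close> the component it came from, and the local embedding there is injective.\<close>

lemma glue_local_embeddings:
  assumes \<alpha>: "\<alpha> \<in> Gamma X" and \<beta>: "\<beta> \<in> Gamma X"
    and f: "inj_on f (components \<alpha>)" "f ` components \<alpha> \<subseteq> components \<beta>"
    and loc: "\<And>\<sigma>. \<sigma> \<in> components \<alpha> \<Longrightarrow> \<exists>g. local_embedding \<sigma> (f \<sigma>) g"
  shows "\<exists>g. equivariant_embedding X \<alpha> \<beta> g"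
proof -
  obtain G where G: "\<And>\<sigma>. \<sigma> \<in> components \<alpha> \<Longrightarrow> local_embedding \<sigma> (f \<sigma>) (G \<sigma>)"
    using loc by metis
  let ?c = "component \<alpha>"
  let ?g = "\<lambda>x. G (?c x) x"
  have c: "?c x \<in> components \<alpha>" if "x \<in> X" for x by (rule component_in_components[OF \<alpha> that])
  have dc: "x \<in> dom (?c x)" if "x \<in> X" for x
    using that by (auto simp: dom_component_iff[OF \<alpha>])
  have fc: "f (?c x) \<in> components \<beta>" if "x \<in> X" for x using c[OF that] f(2) by blast
  have gd: "?g x \<in> dom (f (?c x))" if "x \<in> X" for x
    using G[OF c[OF that]] dc[OF that] by (auto simp: local_embedding_def)
  have gX: "?g x \<in> X" if "x \<in> X" for x
    using gd[OF that] map_le_implies_dom_le[OF components_map_le[OF fc[OF that]]] \<beta>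
    by (auto simp: Gamma_def)
  have inj: "inj_on ?g X"
  proof (rule inj_onI)
    fix x y assume x: "x \<in> X" and y: "y \<in> X" and eq: "?g x = ?g y"
    have "f (?c x) = component \<beta> (?g x)" by (rule components_eq_component[OF \<beta> fc[OF x] gd[OF x]])
    also have "\<dots> = component \<beta> (?g y)" using eq by simp
    also have "\<dots> = f (?c y)" by (rule components_eq_component[OF \<beta> fc[OF y] gd[OF y], symmetric])
    finally have "?c x = ?c y" using inj_onD[OF f(1)] c[OF x] c[OF y] by blast
    then show "x = y"
      using eq G[OF c[OF x]] dc[OF x] dc[OF y] by (auto simp: local_embedding_def dest: inj_onD)
  qed
  have "?g (step \<alpha> x) = step \<beta> (?g x)" if x: "x \<in> X" for x
  proof -
    \<comment> \<open>A point and its image share a component, so the same local embedding acts on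
      both.\<close>
    have "(step \<alpha> ^^ 1) x = (step \<alpha> ^^ 0) (step \<alpha> x)" by simp
    then have "?c (step \<alpha> x) = ?c x"
      using component_eq_iff[OF \<alpha> x Gamma_step(2)[OF \<alpha> x]] by metis
    moreover have "step (?c x) x = step \<alpha> x"
      using dc[OF x] components_map_le[OF c[OF x]] by (simp add: step_def map_le_def)
    moreover have "f (?c x) (?g x) = Some (G (?c x) (step (?c x) x))"
      using G[OF c[OF x]] dc[OF x] by (auto simp: local_embedding_def)
    ultimately show ?thesis
      using map_le_step[OF components_map_le[OF fc[OF x]]] by metis
  qed
  then have "equivariant_embedding X \<alpha> \<beta> ?g"
    using inj gX by (auto simp: equivariant_embedding_def)
  then show ?thesis by blast
qed

text \<open>Rays are matched by \<open>inj_of_card_of_disjoint_Un\<close>, so that right rays may go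
  to double rays but not conversely; cycles are matched length by length. The matching is then
  glued.\<close>

lemma embedding_of_card_of_eq:
  assumes \<alpha>: "\<alpha> \<in> Gamma X" and \<beta>: "\<beta> \<in> Gamma X"
    and AB: "|max_right_rays \<alpha> \<union> double_rays \<alpha>| =o |max_right_rays \<beta> \<union> double_rays \<beta>|"
    and B: "|double_rays \<alpha>| =o |double_rays \<beta>|"
    and C: "\<And>n. n \<ge> 1 \<Longrightarrow> |cycles n \<alpha>| =o |cycles n \<beta>|"
  shows "\<exists>g. equivariant_embedding X \<alpha> \<beta> g"
proof -
  let ?R = "\<lambda>\<alpha>. max_right_rays \<alpha> \<union> double_rays \<alpha>"
  obtain f where f: "inj_on f (?R \<alpha>)" "f ` max_right_rays \<alpha> \<subseteq> ?R \<beta>"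
    "f ` double_rays \<alpha> \<subseteq> double_rays \<beta>"
    using inj_of_card_of_disjoint_Un[OF max_right_rays_double_rays_disjoint[OF \<alpha>]
        max_right_rays_double_rays_disjoint[OF \<beta>] AB B] by metis
  have "\<exists>k. n \<ge> 1 \<longrightarrow> bij_betw k (cycles n \<alpha>) (cycles n \<beta>)" for n
    using C card_of_ordIso by blast
  then obtain k where k: "\<And>n. n \<ge> 1 \<Longrightarrow> bij_betw (k n) (cycles n \<alpha>) (cycles n \<beta>)" by metis
  \<comment> \<open>A finite domain marks a cycle, and its cardinality is the length that selects
    the bijection \<open>k\<close>.\<close>
  let ?F = "\<lambda>\<sigma>. if finite (dom \<sigma>) then k (card (dom \<sigma>)) \<sigma> else f \<sigma>"
  have Fc: "?F \<sigma> = k n \<sigma>" "?F \<sigma> \<in> cycles n \<beta>" if "\<sigma> \<in> cycles n \<alpha>" "n \<ge> 1" for \<sigma> n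
    using card_dom_cycle[OF that(1)] k[OF that(2)] that(1) by (auto dest: bij_betwE)
  have Fr: "?F \<sigma> = f \<sigma>" "?F \<sigma> \<in> ?R \<beta>" if "\<sigma> \<in> ?R \<alpha>" for \<sigma>
    using infinite_dom_ray[OF that] f that by auto
  have cases: "\<sigma> \<in> ?R \<alpha> \<or> (\<exists>n\<ge>1. \<sigma> \<in> cycles n \<alpha>)" if "\<sigma> \<in> components \<alpha>" for \<sigma>
    using that by (auto simp: components_def)
  \<comment> \<open>\<open>?F\<close> keeps both the kind of a component and the length of a cycle,
    so equal values come from the same branch and the same \<open>k n\<close>.\<close>
  have fin: "finite (dom (?F \<sigma>)) = finite (dom \<sigma>) \<and> (finite (dom \<sigma>) \<longrightarrow> card (dom (?F \<sigma>)) = card (dom \<sigma>))"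
    if "\<sigma> \<in> components \<alpha>" for \<sigma>
    using cases[OF that]
  proof (elim disjE exE conjE)
    assume "\<sigma> \<in> ?R \<alpha>"
    then show ?thesis using infinite_dom_ray[OF Fr(2)] infinite_dom_ray by blast
  next
    fix n :: nat assume "n \<ge> 1" "\<sigma> \<in> cycles n \<alpha>"
    then show ?thesis using card_dom_cycle[OF Fc(2)] card_dom_cycle by metis
  qed
  have "inj_on ?F (components \<alpha>)"
  proof (rule inj_onI)
    fix \<sigma> \<tau> assume \<sigma>: "\<sigma> \<in> components \<alpha>" and \<tau>: "\<tau> \<in> components \<alpha>" and eq: "?F \<sigma> = ?F \<tau>"
    have same: "finite (dom \<sigma>) = finite (dom \<tau>)" "finite (dom \<sigma>) \<Longrightarrow> card (dom \<sigma>) = card (dom \<tau>)"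
      using fin[OF \<sigma>] fin[OF \<tau>] eq by metis+
    show "\<sigma> = \<tau>"
    proof (cases "finite (dom \<sigma>)")
      case True
      then obtain m n where m: "m \<ge> 1" "\<sigma> \<in> cycles m \<alpha>" and n: "n \<ge> 1" "\<tau> \<in> cycles n \<alpha>"
        using cases[OF \<sigma>] cases[OF \<tau>] same(1) infinite_dom_ray by metis
      have "m = n" using card_dom_cycle[OF m(2)] card_dom_cycle[OF n(2)] same(2)[OF True] by simp
      moreover have "k m \<sigma> = k n \<tau>" using eq Fc(1)[OF m(2,1)] Fc(1)[OF n(2,1)] by simp
      ultimately show ?thesis
        using k[OF m(1)] m n by (metis bij_betw_imp_inj_on inj_onD)
    next
      case False
      then have "\<sigma> \<in> ?R \<alpha>" "\<tau> \<in> ?R \<alpha>"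
        using cases[OF \<sigma>] cases[OF \<tau>] same(1) card_dom_cycle by metis+
      moreover have "f \<sigma> = f \<tau>" using eq False same(1) by simp
      ultimately show ?thesis using inj_onD[OF f(1)] by blast
    qed
  qed
  moreover have "?F ` components \<alpha> \<subseteq> components \<beta>"
  proof (rule image_subsetI)
    fix \<sigma> assume \<sigma>: "\<sigma> \<in> components \<alpha>"
    show "?F \<sigma> \<in> components \<beta>"
      using cases[OF \<sigma>] Fc(2)[of \<sigma>] Fr(2)[of \<sigma>] unfolding components_def by blast
  qed
  moreover have "\<exists>g. local_embedding \<sigma> (?F \<sigma>) g" if \<sigma>: "\<sigma> \<in> components \<alpha>" for \<sigma>
  proof -
    consider "\<sigma> \<in> max_right_rays \<alpha>" | "\<sigma> \<in> double_rays \<alpha>" | n where "n \<ge> 1" "\<sigma> \<in> cycles n \<alpha>"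
      using cases[OF \<sigma>] by blast
    then show ?thesis
    proof cases
      case 1
      then show ?thesis using max_right_ray_embeds[OF 1] Fr(2)[of \<sigma>] by blast
    next
      case 2
      then have "f \<sigma> \<in> double_rays \<beta>" using f(3) by blast
      then show ?thesis using double_ray_embeds[OF 2] Fr(1)[of \<sigma>] 2 by (metis UnI2)
    next
      case 3
      then show ?thesis using cycle_embeds[OF 3(2) Fc(2)[OF 3(2,1)]] by blast
    qed
  qed
  ultimately show ?thesis by (rule glue_local_embeddings[OF \<alpha> \<beta>])
qed

theorem theorem7p6:
  fixes X :: "'a set" and \<alpha> \<beta> :: "'a \<rightharpoonup> 'a"
  assumes "X \<noteq> {}" and "\<alpha> \<in> Gamma X" and "\<beta> \<in> Gamma X"
  shows "c_conjugate (Gamma X) comp_lr \<alpha> \<beta> \<longleftrightarrow>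
    |max_right_rays \<alpha>| +c |double_rays \<alpha>| =o |max_right_rays \<beta>| +c |double_rays \<beta>| \<and>
    |double_rays \<alpha>| =o |double_rays \<beta>| \<and>
    (\<forall>n\<ge>1. |cycles n \<alpha>| =o |cycles n \<beta>| )"
proof -
  note \<alpha> = assms(2) and \<beta> = assms(3)
  let ?R = "\<lambda>\<alpha>. max_right_rays \<alpha> \<union> double_rays \<alpha>"
  \<comment> \<open>Disjointness turns the cardinal sum into the cardinality of the single set of
    aperiodic components.\<close>
  have sum: "|?R \<gamma>| =o |max_right_rays \<gamma>| +c |double_rays \<gamma>|" if "\<gamma> \<in> Gamma X" for \<gamma>
    by (rule card_of_disjoint_Un[OF max_right_rays_double_rays_disjoint[OF that]])
  have sums: "|max_right_rays \<alpha>| +c |double_rays \<alpha>| =o |max_right_rays \<beta>| +c |double_rays \<beta>|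
    \<longleftrightarrow> |?R \<alpha>| =o |?R \<beta>|"
    using sum[OF \<alpha>] sum[OF \<beta>] by (meson ordIso_symmetric ordIso_transitive)
  show ?thesis
    unfolding c_conjugate_Gamma_iff[OF \<alpha> \<beta>] sums
  proof (intro iffI; elim conjE exE)
    fix g h assume g: "equivariant_embedding X \<alpha> \<beta> g" and h: "equivariant_embedding X \<beta> \<alpha> h"
    show "|?R \<alpha>| =o |?R \<beta>| \<and> |double_rays \<alpha>| =o |double_rays \<beta>| \<and>
      (\<forall>n\<ge>1. |cycles n \<alpha>| =o |cycles n \<beta>| )"
      \<comment> \<open>The two embeddings give opposite inequalities, which
        \<open>ordIso_iff_ordLeq\<close> combines; this is where Schroeder-Bernstein enters.\<close>
      using embedding_card_of_invariants[OF \<alpha> \<beta> g] embedding_card_of_invariants[OF \<beta> \<alpha> h]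
      by (simp add: ordIso_iff_ordLeq)
  next
    assume *: "|?R \<alpha>| =o |?R \<beta>|" "|double_rays \<alpha>| =o |double_rays \<beta>|"
      "\<forall>n\<ge>1. |cycles n \<alpha>| =o |cycles n \<beta>|"
    show "(\<exists>g. equivariant_embedding X \<alpha> \<beta> g) \<and> (\<exists>h. equivariant_embedding X \<beta> \<alpha> h)"
      using embedding_of_card_of_eq[OF \<alpha> \<beta>] embedding_of_card_of_eq[OF \<beta> \<alpha>] *
      by (simp add: ordIso_symmetric)
  qed
qed

end
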